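(* Let $(a,F)$ be a game with associated measure $\rho$ on $(0,\infty)$. If $E<\infty$ and the function $x\mapsto\int_0^x\rho(dt)$ is regularly varying of index $r$, then $0\le r\le 1$ and $\lim_{m\to E^-}\dfrac{u_{\max}(m)}{E-m}=\dfrac{1-r}{2-r}$.
   Context: A game is a pair $(a,F)$, where $F$ is a probability distribution function on an interval $I\subseteq\mathbb{R}$ (so $\int_I dF=1$) and $a:I\to\mathbb{R}$ is measurable and not constant $F$-almost everywhere. Put $E=\int_I a(x)\,dF$, $\xi=\operatorname{ess\,inf}_{x\in I}a(x)$ (with respect to $F$), and $H_\xi=\int_I \frac{1}{a(x)-\xi}\,dF\in(0,\infty]$, where $H_\xi=\infty$ if $\int_{a(x)=\xi}dF>0$, and $1/H_\xi=0$ if $H_\xi=\infty$. Standing assumptions: $E>0$ and $\xi>-\infty$. One has $\xi+1/H_\xi<E$. Define $\Psi(c)=1/\int_I (a(x)+c)^{-1}dF-c$ for $c>-\xi$. For $m\in(\xi+1/H_\xi,E)$ and $0<u<E-m$, the optimal proportion of investment at price $u$ for the translated game $(a-m,F)$ is the unique $t=t_u^{(m)}\in(0,u/(u+m-\xi))$ with $\int_I \frac{a(x)-m-u}{(a(x)-m)t-tu+u}\,dF=0$. Then $u_{\max}(m)$ denotes the unique number in $(0,E-m)$ such that $u\mapsto t_u^{(m)}$ is strictly increasing on $(0,u_{\max}(m))$ and strictly decreasing on $(u_{\max}(m),E-m)$. The measure $\rho$ associated with the game is the unique measure on $(0,\infty)$ with $\int_0^\infty\frac{1}{t(t+1)}\rho(dt)<\infty$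 and $\Psi(c)=\xi+\frac1{H_\xi}+\int_0^\infty\frac{c+\xi}{t(t+c+\xi)}\rho(dt)$ for all $c>-\xi$. A measurable function $f$, positive for all large $x$, is regularly varying of index $r\in\mathbb{R}$ (written $f\in R_r$) if $\lim_{x\to\infty}f(\lambda x)/f(x)=\lambda^r$ for every $\lambda>0$. *)

theory Defs
  imports "HOL-Probability.Probability"
begin

text \<open>A distribution function that is given on an interval \<open>I\<close> only is extended by 0 to the left
  and by 1 to the right of \<open>I\<close>.\<close>

definition distribution_function_on :: "real set \<Rightarrow> (real \<Rightarrow> real) \<Rightarrow> bool" where
  "distribution_function_on I F \<longleftrightarrow>
     is_interval I \<and> mono F \<and> (\<forall>x. continuous (at_right x) F) \<and>
     (F \<longlongrightarrow> 0) at_bot \<and> (F \<longlongrightarrow> 1) at_top \<and>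
     emeasure (interval_measure F) I = 1"

text \<open>The measure \<open>dF\<close> on \<open>I\<close>. It is completed, so that a function is measurable as soon as it
  is Lebesgue--Stieltjes measurable with respect to \<open>F\<close>; all Borel functions are covered, with the
  same integrals.\<close>

definition dF_on :: "real set \<Rightarrow> (real \<Rightarrow> real) \<Rightarrow> real measure" where
  "dF_on I F = restrict_space (completion (interval_measure F)) I"

text \<open>The expectation is the extended Lebesgue integral; it takes the value \<open>\<infinity>\<close> if \<open>a\<close> is
  essentially bounded below and not integrable.\<close>

definition game_E :: "real measure \<Rightarrow> (real \<Rightarrow> real) \<Rightarrow> ereal" where
  "game_E M a =
     enn2ereal (\<integral>\<^sup>+x. ennreal (a x) \<partial>M) - enn2ereal (\<integral>\<^sup>+x. ennreal (- a x) \<partial>M)"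

definition ess_inf :: "real measure \<Rightarrow> (real \<Rightarrow> real) \<Rightarrow> ereal" where
  "ess_inf M a = - esssup M (\<lambda>x. - ereal (a x))"

definition game :: "real set \<Rightarrow> (real \<Rightarrow> real) \<Rightarrow> (real \<Rightarrow> real) \<Rightarrow> bool" where
  "game I a F \<longleftrightarrow>
     distribution_function_on I F \<and>
     a \<in> borel_measurable (dF_on I F) \<and>
     \<not> (\<exists>k. AE x in dF_on I F. a x = k) \<and>
     0 < game_E (dF_on I F) a \<and>
     - \<infinity> < ess_inf (dF_on I F) a"

definition game_xi :: "real measure \<Rightarrow> (real \<Rightarrow> real) \<Rightarrow> real" where
  "game_xi M a = real_of_ereal (ess_inf M a)"

text \<open>In \<^typ>\<open>ennreal\<close> the inverse of 0 is \<open>\<infinity>\<close> and the inverse of \<open>\<infinity>\<close> is 0. Hence the integral is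
  \<open>\<infinity>\<close> if \<open>a = \<xi>\<close> on a set of positive measure, and \<open>1 / H = 0\<close> if \<open>H = \<infinity>\<close>.\<close>

definition game_H :: "real measure \<Rightarrow> (real \<Rightarrow> real) \<Rightarrow> ennreal" where
  "game_H M a = (\<integral>\<^sup>+x. 1 / ennreal (a x - game_xi M a) \<partial>M)"

definition game_lower :: "real measure \<Rightarrow> (real \<Rightarrow> real) \<Rightarrow> real" where
  "game_lower M a = game_xi M a + enn2real (1 / game_H M a)"

definition game_Psi :: "real measure \<Rightarrow> (real \<Rightarrow> real) \<Rightarrow> real \<Rightarrow> real" where
  "game_Psi M a c = 1 / (LINT x|M. 1 / (a x + c)) - c"

definition opt_prop :: "real measure \<Rightarrow> (real \<Rightarrow> real) \<Rightarrow> real \<Rightarrow> real \<Rightarrow> real" where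
  "opt_prop M a m u =
     (THE t. t \<in> {0<..<u / (u + m - game_xi M a)} \<and>
        (LINT x|M. (a x - m - u) / ((a x - m) * t - t * u + u)) = 0)"

definition u_max :: "real measure \<Rightarrow> (real \<Rightarrow> real) \<Rightarrow> real \<Rightarrow> real" where
  "u_max M a m =
     (THE v. 0 < v \<and> ereal v < game_E M a - ereal m \<and>
        strict_mono_on {0<..<v} (opt_prop M a m) \<and>
        strict_antimono_on {u. v < u \<and> ereal u < game_E M a - ereal m} (opt_prop M a m))"

definition associated_measure :: "real measure \<Rightarrow> (real \<Rightarrow> real) \<Rightarrow> real measure \<Rightarrow> bool" where
  "associated_measure M a \<rho> \<longleftrightarrow>
     sets \<rho> = sets (restrict_space borel {0<..}) \<and>
     (\<integral>\<^sup>+t. ennreal (1 / (t * (t + 1))) \<partial>\<rho>) < \<infinity> \<and>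
     (\<forall>c > - game_xi M a.
        game_Psi M a c =
          game_lower M a + (LINT t|\<rho>. (c + game_xi M a) / (t * (t + c + game_xi M a))))"

definition regularly_varying :: "real \<Rightarrow> (real \<Rightarrow> real) \<Rightarrow> bool" where
  "regularly_varying r f \<longleftrightarrow>
     f \<in> borel_measurable borel \<and>
     (\<forall>\<^sub>F x in at_top. 0 < f x) \<and>
     (\<forall>l>0. ((\<lambda>x. f (l * x) / f x) \<longlongrightarrow> l powr r) at_top)"

end

theory Submission
  imports Defs "HOL-Real_Asymp.Real_Asymp"
begin

text \<open>
  Put \<open>s = c + \<xi>\<close>, \<open>\<mu> = m - \<xi>\<close> and \<open>B = E - \<xi>\<close>. Letting \<open>c \<rightarrow> \<infinity>\<close> in the representation of \<open>\<Psi>\<close> shows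
  that \<open>\<integral> 1/t d\<rho>\<close> is finite, and then \<open>\<Psi>(c) - \<xi> = B - R s\<close> with the Stieltjes transform
  \<open>R s = \<integral> 1/(t + s) d\<rho>\<close>. The optimality equation at price \<open>u\<close> becomes \<open>B - R s = \<mu> + u\<close> with
  \<open>t = u / (s + u + \<mu>)\<close>, so the optimal proportion is largest at the unique \<open>s\<close> with
  \<open>P s * (s + \<mu>) = B - \<mu> - R s\<close>, where \<open>P = - R'\<close>, and the common value of the two sides is
  \<open>u_max(m)\<close>. As \<open>m\<close> tends to \<open>E\<close> this \<open>s\<close> tends to infinity, so the claim reduces to
  \<open>s * P s / R s \<rightarrow> 1 - r\<close>. Writing \<open>R s = \<integral> N x / (x + s)^2 dx\<close> with \<open>N x = \<rho>(0, x]\<close>, regular variation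
  of \<open>N\<close> with index \<open>r\<close> passes to \<open>R\<close> with index \<open>r - 1\<close>, and monotonicity of \<open>P\<close> gives the limit.
\<close>

section \<open>Strict integral inequalities and a difference quotient at 1\<close>

lemma integral_less_nonnull:
  fixes f g :: "'a \<Rightarrow> real"
  assumes "integrable M f" "integrable M g" "AE x in M. f x < g x" "emeasure M (space M) \<noteq> 0"
  shows "integral\<^sup>L M f < integral\<^sup>L M g"
proof -
  have int: "integrable M (\<lambda>x. g x - f x)" using assms by simp
  have nonneg: "AE x in M. 0 \<le> g x - f x" using assms(3) by eventually_elim simp
  have "\<not> (AE x in M. g x - f x = 0)"
  proof
    assume "AE x in M. g x - f x = 0"
    with assms(3) have "AE x in M. False" by eventually_elim simp
    thus False using assms(4) by (simp add: AE_iff_null null_sets_def)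
  qed
  hence "(LINT x|M. g x - f x) \<noteq> 0"
    using integral_nonneg_eq_0_iff_AE[OF int nonneg] by simp
  moreover have "(LINT x|M. g x - f x) \<ge> 0" using nonneg by (rule integral_nonneg_AE)
  ultimately show ?thesis using assms by simp
qed

lemma powr_difference_quotient:
  "((\<lambda>l::real. (l powr p - 1) / (l - 1)) \<longlongrightarrow> p) (at 1)"
proof -
  have "((\<lambda>l::real. l powr p) has_real_derivative p) (at 1)"
    by (auto intro!: derivative_eq_intros)
  thus ?thesis by (simp add: has_field_derivative_iff)
qed

section \<open>The Stieltjes transform of a measure on the positive half-line\<close>

locale stieltjes_measure =
  fixes \<rho> :: "real measure"
  assumes sets_rho: "sets \<rho> = sets (restrict_space borel {0<..})"
    and integrable_inverse: "integrable \<rho> (\<lambda>t. 1 / t)"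
    and nonzero: "emeasure \<rho> (space \<rho>) \<noteq> 0"
begin

definition R :: "real \<Rightarrow> real" where
  "R s = (LINT t|\<rho>. 1 / (t + s))"

definition P :: "real \<Rightarrow> real" where
  "P s = (LINT t|\<rho>. 1 / (t + s)\<^sup>2)"

definition N :: "real \<Rightarrow> real" where
  "N x = measure \<rho> {0<..x}"

lemma space_rho: "space \<rho> = {0<..}"
  using sets_eq_imp_space_eq[OF sets_rho] by (simp add: space_restrict_space)

lemma borel_measurable_rho [measurable (raw)]:
  assumes "f \<in> borel_measurable borel" shows "f \<in> borel_measurable \<rho>"
proof -
  have "f \<in> borel_measurable (restrict_space borel {0<..})"
    using assms by (rule measurable_restrict_space1)
  thus ?thesis using measurable_cong_sets[OF sets_rho refl] by blast
qed

lemma Ioc_in_sets: "{0<..x} \<in> sets \<rho>"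
  unfolding sets_rho by (auto simp: sets_restrict_space image_iff intro!: bexI[of _ "{0<..x}"])

lemma integrable_R: "s > 0 \<Longrightarrow> integrable \<rho> (\<lambda>t. 1 / (t + s))"
  by (rule Bochner_Integration.integrable_bound[OF integrable_inverse])
     (auto simp: space_rho intro!: AE_I2 divide_left_mono)

lemma integrable_P:
  assumes "s > 0" shows "integrable \<rho> (\<lambda>t. 1 / (t + s)\<^sup>2)"
proof (rule Bochner_Integration.integrable_bound)
  show "integrable \<rho> (\<lambda>t. (1 / s) * (1 / (t + s)))"
    using integrable_R[OF assms] by (rule integrable_mult_right)
  show "AE t in \<rho>. norm (1 / (t + s)\<^sup>2) \<le> norm ((1 / s) * (1 / (t + s)))"
    using assms by (auto simp: space_rho power2_eq_square intro!: AE_I2 divide_left_mono)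
qed auto

lemma R_pos:
  assumes "s > 0" shows "R s > 0"
proof -
  have "(LINT t|\<rho>. 0) < R s"
    unfolding R_def using assms
    by (intro integral_less_nonnull integrable_R nonzero AE_I2) (auto simp: space_rho)
  thus ?thesis by simp
qed

lemma P_pos:
  assumes "s > 0" shows "P s > 0"
proof -
  have "(LINT t|\<rho>. 0) < P s"
    unfolding P_def using assms
    by (intro integral_less_nonnull integrable_P nonzero AE_I2) (auto simp: space_rho)
  thus ?thesis by simp
qed

text \<open>Integrating the pointwise identity
  \<open>1 / (t + s) - 1 / (t + s') = (s' - s) / ((t + s) * (t + s'))\<close> compares secants of
  the convex function \<open>R\<close> with its tangent slope \<open>- P s\<close>. Together with
  \<open>chord_lower\<close> this replaces any differentiation under the integral sign.\<close>

lemma chord_upper: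
  assumes "0 < s" "s < s'"
  shows "R s - R s' < (s' - s) * P s"
proof -
  have "R s - R s' = (LINT t|\<rho>. 1 / (t + s) - 1 / (t + s'))"
    unfolding R_def using assms by (simp add: integrable_R)
  also have "\<dots> < (LINT t|\<rho>. (s' - s) * (1 / (t + s)\<^sup>2))"
  proof (rule integral_less_nonnull)
    show "AE t in \<rho>. 1 / (t + s) - 1 / (t + s') < (s' - s) * (1 / (t + s)\<^sup>2)"
    proof (rule AE_I2)
      fix t assume "t \<in> space \<rho>"
      hence t: "t > 0" by (simp add: space_rho)
      have "1 / (t + s) - 1 / (t + s') = (s' - s) * (1 / ((t + s) * (t + s')))"
        using t assms by (simp add: field_simps)
      also have "\<dots> < (s' - s) * (1 / (t + s)\<^sup>2)"
        unfolding power2_eq_square using t assms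
        by (intro mult_strict_left_mono divide_strict_left_mono) auto
      finally show "1 / (t + s) - 1 / (t + s') < (s' - s) * (1 / (t + s)\<^sup>2)" .
    qed
  qed (use assms nonzero in \<open>auto intro!: integrable_R integrable_P integrable_mult_right
          Bochner_Integration.integrable_diff simp del: times_divide_eq_right\<close>)
  also have "\<dots> = (s' - s) * P s"
    unfolding P_def by (rule integral_mult_right_zero)
  finally show ?thesis .
qed

lemma chord_lower:
  assumes "0 < s" "s < s'"
  shows "(s' - s) * P s' < R s - R s'"
proof -
  have "(s' - s) * P s' = (LINT t|\<rho>. (s' - s) * (1 / (t + s')\<^sup>2))"
    unfolding P_def by (rule integral_mult_right_zero[symmetric])
  also have "\<dots> < (LINT t|\<rho>. 1 / (t + s) - 1 / (t + s'))"
  proof (rule integral_less_nonnull)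
    show "AE t in \<rho>. (s' - s) * (1 / (t + s')\<^sup>2) < 1 / (t + s) - 1 / (t + s')"
    proof (rule AE_I2)
      fix t assume "t \<in> space \<rho>"
      hence t: "t > 0" by (simp add: space_rho)
      have "(s' - s) * (1 / (t + s')\<^sup>2) < (s' - s) * (1 / ((t + s) * (t + s')))"
        unfolding power2_eq_square using t assms
        by (intro mult_strict_left_mono divide_strict_left_mono) auto
      also have "\<dots> = 1 / (t + s) - 1 / (t + s')"
        using t assms by (simp add: field_simps)
      finally show "(s' - s) * (1 / (t + s')\<^sup>2) < 1 / (t + s) - 1 / (t + s')" .
    qed
  qed (use assms nonzero in \<open>auto intro!: integrable_R integrable_P integrable_mult_right
          Bochner_Integration.integrable_diff simp del: times_divide_eq_right\<close>)
  also have "\<dots> = R s - R s'" 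
    unfolding R_def using assms by (simp add: integrable_R)
  finally show ?thesis .
qed

lemma R_strict_antimono: "0 < s \<Longrightarrow> s < s' \<Longrightarrow> R s' < R s"
  using chord_lower[of s s'] P_pos[of s'] mult_pos_pos[of "s' - s" "P s'"] by linarith

text \<open>\<open>P s'\<close> and \<open>P s\<close> lie on either side of the same secant slope
  \<open>(R s - R s') / (s' - s)\<close>.\<close>

lemma P_strict_antimono: "0 < s \<Longrightarrow> s < s' \<Longrightarrow> P s' < P s"
  using chord_lower[of s s'] chord_upper[of s s']
  by (meson less_trans mult_less_cancel_left_pos diff_gt_0_iff_gt)

lemma continuous_R: "continuous_on {0<..} R"
proof (rule continuous_on_sequentiallyI)
  fix x :: "nat \<Rightarrow> real" and s
  assume x: "\<forall>n. x n \<in> {0<..}" "s \<in> {0<..}" "x \<longlonglongrightarrow> s"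
  show "(\<lambda>n. R (x n)) \<longlonglongrightarrow> R s"
    unfolding R_def
  proof (rule integral_dominated_convergence[where w = "\<lambda>t. 1 / t"])
    show "AE t in \<rho>. (\<lambda>n. 1 / (t + x n)) \<longlonglongrightarrow> 1 / (t + s)"
      using x by (auto simp: space_rho intro!: AE_I2 tendsto_intros)
    show "AE t in \<rho>. norm (1 / (t + x n)) \<le> 1 / t" for n
      using x(1)[rule_format, of n] by (auto simp: space_rho intro!: AE_I2 divide_left_mono)
  qed (auto simp: integrable_inverse)
qed

text \<open>Dominated convergence needs arguments bounded away from 0: \<open>1 / t\<^sup>2\<close>
  may fail to be integrable near 0, whereas \<open>1 / (t + c)\<^sup>2\<close> is integrable for
  \<open>c > 0\<close>.\<close>

lemma continuous_P:
  assumes "c > 0" shows "continuous_on {c..} P"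
proof (rule continuous_on_sequentiallyI)
  fix x :: "nat \<Rightarrow> real" and s
  assume x: "\<forall>n. x n \<in> {c..}" "s \<in> {c..}" "x \<longlonglongrightarrow> s"
  show "(\<lambda>n. P (x n)) \<longlonglongrightarrow> P s"
    unfolding P_def
  proof (rule integral_dominated_convergence[where w = "\<lambda>t. 1 / (t + c)\<^sup>2"])
    show "AE t in \<rho>. (\<lambda>n. 1 / (t + x n)\<^sup>2) \<longlonglongrightarrow> 1 / (t + s)\<^sup>2"
      using x assms by (auto simp: space_rho intro!: AE_I2 tendsto_intros)
    show "AE t in \<rho>. norm (1 / (t + x n)\<^sup>2) \<le> 1 / (t + c)\<^sup>2" for n
      using x(1)[rule_format, of n] assms
      by (auto simp: space_rho intro!: AE_I2 divide_left_mono power_mono)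
  qed (auto simp: integrable_P assms)
qed

lemma R_tendsto_0: "(R \<longlongrightarrow> 0) at_top"
proof -
  have "((\<lambda>s. LINT t|\<rho>. 1 / (t + s)) \<longlongrightarrow> (LINT t|\<rho>. 0)) at_top"
  proof (rule integral_dominated_convergence_at_top[where w = "\<lambda>t. 1 / t"])
    show "AE t in \<rho>. ((\<lambda>s. 1 / (t + s)) \<longlongrightarrow> 0) at_top"
      by (intro AE_I2) real_asymp
    show "\<forall>\<^sub>F s in at_top. AE t in \<rho>. norm (1 / (t + s)) \<le> 1 / t"
      using eventually_gt_at_top[of 0]
      by eventually_elim (auto simp: space_rho intro!: AE_I2 divide_left_mono)
  qed (auto simp: integrable_inverse)
  thus ?thesis by (simp add: R_def[abs_def])
qed

section \<open>The distribution function \<open>N\<close> and its relation to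
  \<open>R\<close>\<close>

lemma emeasure_Ioc_le: "emeasure \<rho> {0<..x} \<le> ennreal (x * (LINT t|\<rho>. 1 / t))"
proof (cases "x > 0")
  case True
  have "emeasure \<rho> {0<..x} = (\<integral>\<^sup>+t. indicator {0<..x} t \<partial>\<rho>)"
    by (simp add: Ioc_in_sets)
  \<comment> \<open>Markov's inequality: \<open>1 \<le> x / t\<close> on
    \<open>{0<..x}\<close>.\<close>
  also have "\<dots> \<le> (\<integral>\<^sup>+t. ennreal (x * (1 / t)) \<partial>\<rho>)"
    using True by (intro nn_integral_mono) (auto simp: space_rho indicator_def ennreal_1[symmetric]
      simp del: ennreal_1 intro!: ennreal_leI)
  also have "\<dots> = ennreal (LINT t|\<rho>. x * (1 / t))"
    using True
    by (intro nn_integral_eq_integral integrable_mult_right integrable_inverse)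
       (auto simp: space_rho intro!: AE_I2)
  also have "(LINT t|\<rho>. x * (1 / t)) = x * (LINT t|\<rho>. 1 / t)"
    by (rule integral_mult_right_zero)
  finally show ?thesis .
qed auto

text \<open>Finiteness has to be known first, because \<open>measure\<close> returns 0 on sets of
  infinite measure.\<close>

lemma emeasure_Ioc: "emeasure \<rho> {0<..x} = ennreal (N x)"
  unfolding N_def using emeasure_Ioc_le[of x]
  by (intro emeasure_eq_ennreal_measure) (auto simp: top_unique)

lemma N_le: "x > 0 \<Longrightarrow> N x \<le> x * (LINT t|\<rho>. 1 / t)"
  using emeasure_Ioc_le[of x] unfolding emeasure_Ioc
  by (subst (asm) ennreal_le_iff) (auto simp: space_rho intro!: mult_nonneg_nonneg integral_nonneg_AE AE_I2)

lemma N_nonneg: "N x \<ge> 0" by (simp add: N_def)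

lemma N_nonpos: "x \<le> 0 \<Longrightarrow> N x = 0" by (simp add: N_def)

lemma mono_N: "mono N"
proof
  fix x y :: real assume "x \<le> y"
  hence "emeasure \<rho> {0<..x} \<le> emeasure \<rho> {0<..y}" by (intro emeasure_mono Ioc_in_sets) auto
  thus "N x \<le> N y" by (simp add: emeasure_Ioc N_nonneg)
qed

lemma borel_measurable_N [measurable]: "N \<in> borel_measurable borel"
  by (rule borel_measurable_mono[OF mono_N])

text \<open>On \<open>{0<..x}\<close> the kernel is at least \<open>1 / (x + s)\<close>. So
  \<open>R\<close> decays no faster than a multiple of \<open>1 / s\<close>, which later absorbs
  error terms of order \<open>1 / s\<^sup>2\<close>.\<close>

lemma R_ge:
  assumes "s > 0" "x > 0" shows "N x / (x + s) \<le> R s"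
proof -
  have "ennreal (N x / (x + s)) = (\<integral>\<^sup>+t. ennreal (1 / (x + s)) * indicator {0<..x} t \<partial>\<rho>)"
    using assms by (simp add: nn_integral_cmult_indicator Ioc_in_sets emeasure_Ioc
        flip: ennreal_mult' )
  also have "\<dots> \<le> (\<integral>\<^sup>+t. ennreal (1 / (t + s)) \<partial>\<rho>)"
    using assms by (intro nn_integral_mono) (auto simp: space_rho indicator_def intro!: ennreal_leI divide_left_mono)
  also have "\<dots> = ennreal (R s)"
    unfolding R_def using assms
    by (intro nn_integral_eq_integral integrable_R) (auto simp: space_rho intro!: AE_I2)
  finally show ?thesis using R_pos[OF assms(1)] by simp
qed

lemma sigma_finite: "sigma_finite_measure \<rho>"
proof
  show "\<exists>A. countable A \<and> A \<subseteq> sets \<rho> \<and> \<Union> A = space \<rho> \<and> (\<forall>a\<in>A. emeasure \<rho> a \<noteq> \<infinity>)"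
  proof (intro exI[of _ "range (\<lambda>n::nat. {0<..real n})"] conjI)
    show "\<Union> (range (\<lambda>n::nat. {0<..real n})) = space \<rho>"
      by (auto simp: space_rho real_arch_simple)
  qed (auto simp: Ioc_in_sets emeasure_Ioc)
qed

text \<open>Tonelli's theorem, with \<open>1 / (t + s)\<close> written as the integral of
  \<open>1 / (x + s)\<^sup>2\<close> over \<open>x \<ge> t\<close>. Since \<open>N\<close> vanishes
  at nonpositive arguments, the pole at \<open>x = - s\<close> does no harm.\<close>

lemma nn_integral_N:
  assumes "s > 0"
  shows "(\<integral>\<^sup>+x. ennreal (N x / (x + s)\<^sup>2) \<partial>lborel) = ennreal (R s)"
proof -
  interpret rho: sigma_finite_measure \<rho> by (rule sigma_finite)
  interpret pair_sigma_finite \<rho> lborel ..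
  have inner: "(\<integral>\<^sup>+x. ennreal (1 / (x + s)\<^sup>2) * indicator {t..} x \<partial>lborel) = ennreal (1 / (t + s))"
    if "t > 0" for t
  proof -
    have "(\<integral>\<^sup>+x. ennreal (1 / (x + s)\<^sup>2) * indicator {t..} x \<partial>lborel) = 0 - (- 1 / (t + s))"
    proof (rule nn_integral_FTC_atLeast)
      show "((\<lambda>x. - 1 / (x + s)) \<longlongrightarrow> 0) at_top" by real_asymp
      show "DERIV (\<lambda>x. - 1 / (x + s)) x :> 1 / (x + s)\<^sup>2" if "t \<le> x" for x
        using that assms \<open>t > 0\<close> by (auto intro!: derivative_eq_intros simp: power2_eq_square)
    qed auto
    thus ?thesis by simp
  qed
  have meas: "(\<lambda>(t, x). ennreal (1 / (x + s)\<^sup>2) * indicator {t..} x) \<in> borel_measurable (\<rho> \<Otimes>\<^sub>M lborel)"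
  proof -
    have [measurable]: "fst \<in> borel_measurable (\<rho> \<Otimes>\<^sub>M lborel)"
      by (rule measurable_compose[OF measurable_fst]) simp
    \<comment> \<open>The indicator depends on both variables and is therefore written as a
      comparison of the two projections.\<close>
    have "(\<lambda>p. ennreal (1 / (snd p + s)\<^sup>2) * (if fst p \<le> snd p then 1 else 0)) \<in> borel_measurable (\<rho> \<Otimes>\<^sub>M lborel)"
      by measurable
    thus ?thesis by (simp add: case_prod_beta indicator_def)
  qed
  have "ennreal (R s) = (\<integral>\<^sup>+t. ennreal (1 / (t + s)) \<partial>\<rho>)"
    unfolding R_def using assms
    by (intro nn_integral_eq_integral[symmetric] integrable_R) (auto simp: space_rho intro!: AE_I2)
  also have "\<dots> = (\<integral>\<^sup>+t. \<integral>\<^sup>+x. ennreal (1 / (x + s)\<^sup>2) * indicator {t..} x \<partial>lborel \<partial>\<rho>)"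
    by (intro nn_integral_cong) (auto simp: inner space_rho)
  also have "\<dots> = (\<integral>\<^sup>+x. \<integral>\<^sup>+t. ennreal (1 / (x + s)\<^sup>2) * indicator {t..} x \<partial>\<rho> \<partial>lborel)"
    using Fubini'[OF meas] by simp
  also have "\<dots> = (\<integral>\<^sup>+x. ennreal (N x / (x + s)\<^sup>2) \<partial>lborel)"
  proof (intro nn_integral_cong)
    fix x
    have "(\<integral>\<^sup>+t. ennreal (1 / (x + s)\<^sup>2) * indicator {t..} x \<partial>\<rho>) =
          (\<integral>\<^sup>+t. ennreal (1 / (x + s)\<^sup>2) * indicator {0<..x} t \<partial>\<rho>)"
      by (intro nn_integral_cong) (auto simp: space_rho indicator_def)
    also have "\<dots> = ennreal (N x / (x + s)\<^sup>2)"
      by (simp add: nn_integral_cmult_indicator Ioc_in_sets emeasure_Ioc N_nonneg flip: ennreal_mult')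
    finally show "(\<integral>\<^sup>+t. ennreal (1 / (x + s)\<^sup>2) * indicator {t..} x \<partial>\<rho>) = ennreal (N x / (x + s)\<^sup>2)" .
  qed
  finally show ?thesis by simp
qed

text \<open>The scaling \<open>x = l y\<close> turns the asymptotics of \<open>N (l y) / N y\<close> into a bound on
  \<open>R (l s) / R s\<close>, up to the contribution of \<open>{0<..Y}\<close>.\<close>

lemma R_scale_le:
  assumes "s > 0" "l > 0" "Y > 0" "K \<ge> 0" and N: "\<And>y. y \<ge> Y \<Longrightarrow> N (l * y) \<le> K * N y"
  shows "l * R (l * s) \<le> K * R s + N (l * Y) * Y / s\<^sup>2"
proof -
  have "ennreal (l * R (l * s)) = ennreal l * (\<integral>\<^sup>+x. ennreal (N x / (x + l * s)\<^sup>2) \<partial>lborel)"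
    using assms by (simp add: nn_integral_N ennreal_mult')
  also have "(\<integral>\<^sup>+x. ennreal (N x / (x + l * s)\<^sup>2) \<partial>lborel) =
      ennreal l * (\<integral>\<^sup>+y. ennreal (N (l * y) / (l * y + l * s)\<^sup>2) \<partial>lborel)"
    using assms by (subst nn_integral_real_affine[where c = l and t = 0]) auto
  also have "ennreal l * (ennreal l * (\<integral>\<^sup>+y. ennreal (N (l * y) / (l * y + l * s)\<^sup>2) \<partial>lborel)) =
      (\<integral>\<^sup>+y. ennreal (l * l) * ennreal (N (l * y) / (l * y + l * s)\<^sup>2) \<partial>lborel)"
    using assms by (subst nn_integral_cmult) (auto simp: ennreal_mult' mult.assoc)
  also have "\<dots> = (\<integral>\<^sup>+y. ennreal (N (l * y) / (y + s)\<^sup>2) \<partial>lborel)"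
  proof (intro nn_integral_cong)
    fix y
    have "l * l * (N (l * y) / (l * y + l * s)\<^sup>2) = N (l * y) / (y + s)\<^sup>2"
      using assms by (simp add: power2_eq_square flip: distrib_left)
    thus "ennreal (l * l) * ennreal (N (l * y) / (l * y + l * s)\<^sup>2) = ennreal (N (l * y) / (y + s)\<^sup>2)"
      using assms by (simp flip: ennreal_mult')
  qed
  also have "\<dots> \<le> (\<integral>\<^sup>+y. ennreal K * ennreal (N y / (y + s)\<^sup>2) +
      ennreal (N (l * Y) / s\<^sup>2) * indicator {0..Y} y \<partial>lborel)"
  proof (intro nn_integral_mono)
    fix y
    \<comment> \<open>The ratio is not controlled below \<open>Y\<close>. There monotonicity of
      \<open>N\<close> bounds the integrand by the constant \<open>N (l * Y) / s\<^sup>2\<close>,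
      whose integral over \<open>{0..Y}\<close> is the error term.\<close>
    consider "y \<le> 0" | "0 < y" "y < Y" | "Y \<le> y" by linarith
    thus "ennreal (N (l * y) / (y + s)\<^sup>2) \<le> ennreal K * ennreal (N y / (y + s)\<^sup>2) +
      ennreal (N (l * Y) / s\<^sup>2) * indicator {0..Y} y"
    proof cases
      case 1
      thus ?thesis using assms by (simp add: N_nonpos mult_nonneg_nonpos)
    next
      case 2
      have "N (l * y) / (y + s)\<^sup>2 \<le> N (l * Y) / s\<^sup>2"
        using 2 assms by (intro frac_le monoD[OF mono_N] power_mono) (auto simp: N_nonneg)
      thus ?thesis using 2 by (simp add: ennreal_leI add_increasing)
    next
      case 3
      have "N (l * y) / (y + s)\<^sup>2 \<le> K * (N y / (y + s)\<^sup>2)"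
        using N[OF 3] by (simp add: divide_right_mono)
      thus ?thesis using assms by (simp add: ennreal_leI add_increasing2 flip: ennreal_mult')
    qed
  qed
  also have "\<dots> = ennreal K * (\<integral>\<^sup>+y. ennreal (N y / (y + s)\<^sup>2) \<partial>lborel) + ennreal (N (l * Y) / s\<^sup>2) * ennreal Y"
    using assms by (subst nn_integral_add) (auto simp: nn_integral_cmult nn_integral_cmult_indicator)
  also have "\<dots> = ennreal (K * R s + N (l * Y) * Y / s\<^sup>2)"
    using assms R_pos[of s]
    by (simp add: nn_integral_N N_nonneg flip: ennreal_mult' ennreal_plus)
  finally show ?thesis
    using assms R_pos[of s] by (subst (asm) ennreal_le_iff) (auto simp: N_nonneg)
qed


section \<open>Regular variation of \<open>N\<close> and its transfer to \<open>R\<close> and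
  \<open>P\<close>\<close>

lemma regularly_varying_index_nonneg:
  assumes "regularly_varying r N" shows "0 \<le> r"
proof -
  have "((\<lambda>x. N (2 * x) / N x) \<longlongrightarrow> 2 powr r) at_top"
    using assms by (simp add: regularly_varying_def)
  \<comment> \<open>Monotonicity of \<open>N\<close> keeps the ratio at or above 1, and this passes
    to the limit \<open>2 powr r\<close>.\<close>
  moreover have "\<forall>\<^sub>F x in at_top. 1 \<le> N (2 * x) / N x"
  proof -
    have "\<forall>\<^sub>F x in at_top. 0 < N x" using assms by (simp add: regularly_varying_def)
    with eventually_gt_at_top[of 0] show ?thesis
      by eventually_elim (auto intro!: monoD[OF mono_N])
  qed
  ultimately have "1 \<le> 2 powr r" by (rule tendsto_lowerbound) simp
  thus ?thesis using powr_less_one[of 2 r] by (meson not_less one_less_numeral_iff semiring_norm(76))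
qed

text \<open>An index above 1 would make \<open>N\<close> grow along \<open>2 ^ n * X\<close> at
  least like \<open>q ^ n\<close> with \<open>q > 2\<close>, against the linear bound
  \<open>N_le\<close>.\<close>

lemma regularly_varying_index_le_1:
  assumes "regularly_varying r N" shows "r \<le> 1"
proof (rule ccontr)
  assume "\<not> r \<le> 1"
  hence "2 powr 1 < (2 :: real) powr r" by (intro powr_less_mono) auto
  then obtain q where q: "2 < q" "q < 2 powr r" using dense by auto
  have "((\<lambda>x. N (2 * x) / N x) \<longlongrightarrow> 2 powr r) at_top"
    using assms by (simp add: regularly_varying_def)
  hence "\<forall>\<^sub>F x in at_top. q < N (2 * x) / N x" using q by (auto dest: order_tendstoD)
  moreover have "\<forall>\<^sub>F x in at_top. 0 < N x" using assms by (simp add: regularly_varying_def)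
  ultimately have "\<forall>\<^sub>F x in at_top. 0 < x \<and> 0 < N x \<and> q * N x \<le> N (2 * x)"
    using eventually_gt_at_top[of 0]
    by eventually_elim (auto simp: field_simps)
  then obtain X where X: "\<And>x. x \<ge> X \<Longrightarrow> 0 < x \<and> 0 < N x \<and> q * N x \<le> N (2 * x)"
    by (auto simp: eventually_at_top_linorder)
  have X0: "0 < X" "0 < N X" using X[of X] by auto
  have ge: "q ^ n * N X \<le> N (2 ^ n * X)" for n
  proof (induction n)
    case (Suc n)
    have "q ^ Suc n * N X = q * (q ^ n * N X)" by simp
    also have "\<dots> \<le> q * N (2 ^ n * X)" using Suc q by (intro mult_left_mono) auto
    also have "\<dots> \<le> N (2 * (2 ^ n * X))" using X[of "2 ^ n * X"] X0 by simp
    finally show ?case by (simp add: mult.assoc)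
  qed simp
  define C where "C = (LINT t|\<rho>. 1 / t)"
  have "(q / 2) ^ n \<le> X * C / N X" for n
  proof -
    have "q ^ n * N X \<le> 2 ^ n * X * C"
      using ge[of n] N_le[of "2 ^ n * X"] X0 by (simp add: C_def)
    thus ?thesis using X0 by (simp add: field_simps power_divide)
  qed
  moreover obtain n where "X * C / N X < (q / 2) ^ n"
    using real_arch_pow[of "q / 2"] q by auto
  ultimately show False by (meson not_less)
qed

text \<open>Applying \<open>R_scale_le\<close> with a constant \<open>K'\<close> strictly between
  \<open>l powr r\<close> and \<open>l * K\<close> leaves the surplus
  \<open>(l * K - K') * R s\<close>. For large \<open>s\<close> it dominates the error of order
  \<open>1 / s\<^sup>2\<close>, because \<open>R s \<ge> N Y / (Y + s)\<close>.\<close>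

lemma R_ratio_le:
  assumes rv: "regularly_varying r N" and l: "l > 0" and K: "l powr (r - 1) < K"
  shows "\<forall>\<^sub>F s in at_top. R (l * s) \<le> K * R s"
proof -
  have "l * l powr (r - 1) < l * K" using l K by simp
  hence "l powr r < l * K" using l by (simp add: powr_diff)
  then obtain K' where K': "l powr r < K'" "K' < l * K" using dense by auto
  have K'0: "K' > 0" using K'(1) powr_gt_zero[of l r] l by linarith
  have pos: "\<forall>\<^sub>F x in at_top. 0 < N x" using rv by (simp add: regularly_varying_def)
  have "((\<lambda>x. N (l * x) / N x) \<longlongrightarrow> l powr r) at_top"
    using rv l by (simp add: regularly_varying_def)
  hence "\<forall>\<^sub>F x in at_top. N (l * x) / N x < K'" using K' by (auto dest: order_tendstoD)
  with pos have "\<forall>\<^sub>F x in at_top. 0 < x \<and> 0 < N x \<and> N (l * x) \<le> K' * N x"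
    using eventually_gt_at_top[of 0] by eventually_elim (auto simp: field_simps)
  then obtain Y where Y: "\<And>y. y \<ge> Y \<Longrightarrow> 0 < y \<and> 0 < N y \<and> N (l * y) \<le> K' * N y"
    by (auto simp: eventually_at_top_linorder)
  have Y0: "0 < Y" "0 < N Y" using Y[of Y] by auto
  define D where "D = N (l * Y) * Y"
  define e where "e = (l * K - K') * N Y"
  have e: "e > 0" using K' Y0 by (simp add: e_def)
  have "((\<lambda>s. (D * (Y + s)) / s\<^sup>2) \<longlongrightarrow> 0) at_top" by real_asymp
  hence "\<forall>\<^sub>F s in at_top. (D * (Y + s)) / s\<^sup>2 < e" using e by (rule order_tendstoD)
  thus ?thesis using eventually_gt_at_top[of 0]
  proof eventually_elim
    case (elim s)
    have "D / s\<^sup>2 \<le> e / (Y + s)" using elim Y0 by (simp add: field_simps)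
    also have "\<dots> = (l * K - K') * (N Y / (Y + s))" by (simp add: e_def)
    also have "\<dots> \<le> (l * K - K') * R s"
      using K' Y0 elim by (intro mult_left_mono R_ge) auto
    finally have "D / s\<^sup>2 \<le> (l * K - K') * R s" .
    moreover have "l * R (l * s) \<le> K' * R s + D / s\<^sup>2"
      unfolding D_def using elim l Y0 K'0 Y by (intro R_scale_le) auto
    ultimately have "l * R (l * s) \<le> l * (K * R s)" by (simp add: algebra_simps)
    thus ?case using l by simp
  qed
qed

text \<open>By the chord inequalities \<open>P\<close> is the decreasing function \<open>- R'\<close>, so a one-sided bound on
  \<open>R (l s) / R s\<close> for \<open>l\<close> on either side of 1 is enough (monotone density argument).\<close>

lemma tendsto_log_derivative:
  assumes rv: "regularly_varying r N"
  shows "((\<lambda>s. s * P s / R s) \<longlongrightarrow> 1 - r) at_top"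
proof (rule order_tendstoI)
  fix x assume x: "x < 1 - r"
  \<comment> \<open>The difference quotient provides a single \<open>l > 1\<close> whose power lies
    strictly below the line \<open>1 - x * (l - 1)\<close>. This \<open>l\<close> stays fixed while
    \<open>s\<close> tends to infinity.\<close>
  have "((\<lambda>l::real. (l powr (r - 1) - 1) / (l - 1)) \<longlongrightarrow> r - 1) (at_right 1)"
    using powr_difference_quotient by (rule filterlim_mono) (auto simp: at_within_le_at)
  hence "\<forall>\<^sub>F l in at_right 1. (l powr (r - 1) - 1) / (l - 1) < - x"
    using x by (auto dest!: order_tendstoD)
  moreover have "\<forall>\<^sub>F l in at_right (1::real). 1 < l" by (simp add: eventually_at_right_less)
  ultimately have "\<forall>\<^sub>F l in at_right 1. 1 < l \<and> l powr (r - 1) < 1 - x * (l - 1)"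
    by eventually_elim (auto simp: field_simps)
  then obtain l where l: "1 < l" "l powr (r - 1) < 1 - x * (l - 1)"
    using eventually_happens trivial_limit_at_right_real by blast
  then obtain K where K: "l powr (r - 1) < K" "K < 1 - x * (l - 1)" using dense by blast
  have "\<forall>\<^sub>F s in at_top. R (l * s) \<le> K * R s" using R_ratio_le[OF rv _ K(1)] l by simp
  thus "\<forall>\<^sub>F s in at_top. x < s * P s / R s" using eventually_gt_at_top[of 0]
  proof eventually_elim
    case (elim s)
    note R = R_pos[OF elim(2)]
    have "R s - R (l * s) < (l * s - s) * P s" using elim l by (intro chord_upper) auto
    hence "(1 - K) * R s < (l - 1) * (s * P s)" using elim by (simp add: algebra_simps)
    moreover have "x * (l - 1) * R s < (1 - K) * R s" using K R by simp
    ultimately have "(l - 1) * (x * R s) < (l - 1) * (s * P s)" by (simp add: algebra_simps)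
    hence "x * R s < s * P s" using l by simp
    thus ?case using R by (simp add: field_simps)
  qed
next
  fix x assume x: "1 - r < x"
  \<comment> \<open>For \<open>l < 1\<close> multiplication by \<open>l - 1\<close> reverses the
    inequality, so a lower bound on the quotient again yields an upper bound on
    \<open>l powr (r - 1)\<close>, as \<open>R_ratio_le\<close> requires.\<close>
  have "((\<lambda>l::real. (l powr (r - 1) - 1) / (l - 1)) \<longlongrightarrow> r - 1) (at_left 1)"
    using powr_difference_quotient by (rule filterlim_mono) (auto simp: at_within_le_at)
  hence "\<forall>\<^sub>F l in at_left 1. - x < (l powr (r - 1) - 1) / (l - 1)"
    using x by (intro order_tendstoD(1)[where y = "r - 1"]) auto
  moreover have "\<forall>\<^sub>F l in at_left (1::real). l \<in> {0<..<1}" by (rule eventually_at_left_real) simp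
  ultimately have "\<forall>\<^sub>F l in at_left 1. 0 < l \<and> l < 1 \<and> l powr (r - 1) < 1 + x * (1 - l)"
    by eventually_elim (auto simp: field_simps)
  then obtain l where l: "0 < l" "l < 1" "l powr (r - 1) < 1 + x * (1 - l)"
    using eventually_happens trivial_limit_at_left_real by blast
  then obtain K where K: "l powr (r - 1) < K" "K < 1 + x * (1 - l)" using dense by blast
  have "\<forall>\<^sub>F s in at_top. R (l * s) \<le> K * R s" using R_ratio_le[OF rv _ K(1)] l by simp
  thus "\<forall>\<^sub>F s in at_top. s * P s / R s < x" using eventually_gt_at_top[of 0]
  proof eventually_elim
    case (elim s)
    note R = R_pos[OF elim(2)]
    have "(s - l * s) * P s < R (l * s) - R s" using elim l by (intro chord_lower) auto
    hence "(1 - l) * (s * P s) < (K - 1) * R s" using elim by (simp add: algebra_simps)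
    moreover have "(K - 1) * R s < x * (1 - l) * R s" using K R by simp
    ultimately have "(1 - l) * (s * P s) < (1 - l) * (x * R s)" by (simp add: algebra_simps)
    hence "s * P s < x * R s" using l by simp
    thus ?case using R by (simp add: field_simps)
  qed
qed

end

section \<open>Optimal proportions expressed through the transform\<close>

locale game_transform = stieltjes_measure \<rho> + prob_space M
  for \<rho> M :: "real measure" +
  fixes a :: "real \<Rightarrow> real" and B \<xi> :: real
  assumes a_measurable [measurable]: "a \<in> borel_measurable M"
    and xi: "game_xi M a = \<xi>"
    and a_ge: "AE x in M. \<xi> \<le> a x"
    and E: "game_E M a = ereal (\<xi> + B)"
    and B_pos: "0 < B"
    and Psi: "\<And>s. s > 0 \<Longrightarrow> 1 / (LINT x|M. 1 / (a x - \<xi> + s)) - s = B - R s"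
begin

definition G :: "real \<Rightarrow> real" where
  "G s = (LINT x|M. 1 / (a x - \<xi> + s))"

lemma integrable_G:
  assumes "s > 0" shows "integrable M (\<lambda>x. 1 / (a x - \<xi> + s))"
proof (rule integrable_const_bound[where B = "1 / s"])
  show "AE x in M. norm (1 / (a x - \<xi> + s)) \<le> 1 / s"
    using a_ge by eventually_elim (use assms in \<open>auto intro!: divide_left_mono\<close>)
qed auto

lemma G_pos:
  assumes "s > 0" shows "G s > 0"
proof -
  have "(LINT x|M. 0) < G s"
    unfolding G_def
  proof (intro integral_less_nonnull integrable_G)
    show "AE x in M. 0 < 1 / (a x - \<xi> + s)" using a_ge by eventually_elim (use assms in auto)
  qed (use assms in \<open>auto simp: emeasure_space_1\<close>)
  thus ?thesis by simp
qed

text \<open>With \<open>s = u / t - u - \<mu>\<close> and \<open>w = a x - \<xi> + s\<close>, the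
  denominator equals \<open>t * w\<close> and the numerator \<open>w - u / t\<close>, so only the
  integral \<open>G s\<close> of \<open>1 / w\<close> remains.\<close>

lemma optimality_integral:
  assumes "0 < t" "0 < u / t - u - \<mu>"
  shows "(LINT x|M. (a x - (\<xi> + \<mu>) - u) / ((a x - (\<xi> + \<mu>)) * t - t * u + u)) =
    (1 - u / t * G (u / t - u - \<mu>)) / t"
proof -
  define s where "s = u / t - u - \<mu>"
  have u: "u = (s + u + \<mu>) * t" using assms by (simp add: s_def)
  have "(LINT x|M. (a x - (\<xi> + \<mu>) - u) / ((a x - (\<xi> + \<mu>)) * t - t * u + u)) =
      (LINT x|M. (1 - u / t * (1 / (a x - \<xi> + s))) / t)"
  proof (rule integral_cong_AE)
    show "AE x in M. (a x - (\<xi> + \<mu>) - u) / ((a x - (\<xi> + \<mu>)) * t - t * u + u) =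
        (1 - u / t * (1 / (a x - \<xi> + s))) / t"
      using a_ge
    proof eventually_elim
      case (elim x)
      define w where "w = a x - \<xi> + s"
      have "(a x - (\<xi> + \<mu>)) * t - t * u + u = t * w"
        using u by (simp add: w_def algebra_simps)
      moreover have "w > 0" using elim assms by (simp add: w_def s_def)
      moreover have "a x - (\<xi> + \<mu>) - u = w - u / t" by (simp add: w_def s_def)
      moreover have "(w - u / t) / (t * w) = (1 - u / t * (1 / w)) / t"
        using \<open>w > 0\<close> assms by (simp add: field_simps)
      ultimately show ?case by (simp only: w_def)
    qed
  qed auto
  also have "\<dots> = (1 - u / t * G s) / t"
  proof -
    have "integrable M (\<lambda>x. u / t * (1 / (a x - \<xi> + s)))"
      using integrable_G[of s] assms by (intro integrable_mult_right) (simp add: s_def)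
    hence "(LINT x|M. 1 - u / t * (1 / (a x - \<xi> + s))) =
        (LINT x|M. 1) - (LINT x|M. u / t * (1 / (a x - \<xi> + s)))"
      by (intro Bochner_Integration.integral_diff) auto
    also have "(LINT x|M. u / t * (1 / (a x - \<xi> + s))) = u / t * G s"
      unfolding G_def by (rule integral_mult_right_zero)
    finally show ?thesis by (simp only: integral_divide_zero) (simp add: prob_space)
  qed
  finally show ?thesis by (simp add: s_def)
qed

text \<open>Sending \<open>t\<close> to \<open>s' = u / t - u - \<mu>\<close> maps the admissible
  interval bijectively onto the positive numbers, and \<open>optimality_integral\<close> turns the
  equation into \<open>1 / G s' = u / t\<close>. By \<open>Psi\<close> this reads
  \<open>R s' = R s\<close>, and \<open>R\<close> is injective.\<close>

lemma opt_prop_eq: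
  assumes "0 < u" "0 < \<mu>" "0 < s" and s: "B - R s = \<mu> + u"
  shows "opt_prop M a (\<xi> + \<mu>) u = u / (s + u + \<mu>)"
proof -
  have "(t \<in> {0<..<u / (u + (\<xi> + \<mu>) - game_xi M a)} \<and>
      (LINT x|M. (a x - (\<xi> + \<mu>) - u) / ((a x - (\<xi> + \<mu>)) * t - t * u + u)) = 0) \<longleftrightarrow>
      t = u / (s + u + \<mu>)" (is "?L \<longleftrightarrow> ?R") for t
  proof -
    have dom: "t \<in> {0<..<u / (u + (\<xi> + \<mu>) - game_xi M a)} \<longleftrightarrow> 0 < t \<and> 0 < u / t - u - \<mu>"
      using assms by (auto simp: xi field_simps)
    have zero: "(LINT x|M. (a x - (\<xi> + \<mu>) - u) / ((a x - (\<xi> + \<mu>)) * t - t * u + u)) = 0 \<longleftrightarrow>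
        u / t - u - \<mu> = s" if t: "0 < t" "0 < u / t - u - \<mu>"
    proof -
      define s' where "s' = u / t - u - \<mu>"
      have "(LINT x|M. (a x - (\<xi> + \<mu>) - u) / ((a x - (\<xi> + \<mu>)) * t - t * u + u)) = 0 \<longleftrightarrow>
          u / t * G s' = 1"
        using t by (simp only: optimality_integral s'_def[symmetric]) auto
      also have "\<dots> \<longleftrightarrow> 1 / G s' = u / t" using G_pos[of s'] t by (auto simp: s'_def field_simps)
      also have "\<dots> \<longleftrightarrow> 1 / G s' - s' = \<mu> + u" by (auto simp: s'_def)
      also have "\<dots> \<longleftrightarrow> R s' = R s" using Psi[of s'] t s by (auto simp: s'_def G_def)
      also have "\<dots> \<longleftrightarrow> s' = s"
        using R_strict_antimono[of s s'] R_strict_antimono[of s' s] assms t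
        by (cases s s' rule: linorder_cases) (auto simp: s'_def)
      finally show ?thesis by (simp add: s'_def)
    qed
    show ?thesis
    proof
      assume ?L
      hence "0 < t" "u / t - u - \<mu> = s" using dom zero by auto
      thus ?R using assms by (simp add: field_simps)
    next
      assume t: ?R
      have "0 < t" "u / t = s + u + \<mu>" using assms by (auto simp: t)
      thus ?L using dom zero assms by auto
    qed
  qed
  thus ?thesis unfolding opt_prop_def by simp
qed

text \<open>Parametrizes the prices between 0 and \<open>B - \<mu>\<close> by \<open>s > s0\<close>:
  the parameter \<open>s0\<close> belongs to price 0, and the price tends to
  \<open>B - \<mu>\<close> as \<open>s\<close> tends to infinity.\<close>

lemma ex_transform_eq:
  assumes "0 < s0" "B - R s0 = \<mu>" "0 < u" "u < B - \<mu>"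
  shows "\<exists>s>s0. B - R s = \<mu> + u"
proof -
  have "\<forall>\<^sub>F s in at_top. R s < B - \<mu> - u"
    using R_tendsto_0 assms by (intro order_tendstoD) auto
  hence "\<forall>\<^sub>F s in at_top. s0 < s \<and> R s < B - \<mu> - u"
    using eventually_gt_at_top[of s0] by eventually_elim simp
  then obtain s1 where s1: "s0 < s1" "R s1 < B - \<mu> - u"
    using eventually_happens'[OF trivial_limit_at_top_linorder] by blast
  have "\<exists>s. s0 \<le> s \<and> s \<le> s1 \<and> R s = B - \<mu> - u"
    using assms s1 by (intro IVT2' continuous_on_subset[OF continuous_R]) auto
  then obtain s where s: "s0 \<le> s" "R s = B - \<mu> - u" by blast
  moreover have "s \<noteq> s0" using s assms by auto
  ultimately show ?thesis by (intro exI[of _ s]) auto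
qed

text \<open>Up to a positive factor, \<open>P s * (s + \<mu>) + R s - (B - \<mu>)\<close> is the derivative of the optimal
  proportion with respect to the parameter \<open>s\<close>.\<close>

lemma criterion_antimono:
  assumes "0 < \<mu>" "0 < s" "s < s'"
  shows "P s' * (s' + \<mu>) + R s' < P s * (s + \<mu>) + R s"
proof -
  have "(s + \<mu>) * P s' < (s + \<mu>) * P s" using P_strict_antimono[of s s'] assms by simp
  thus ?thesis using chord_lower[of s s'] assms by (simp add: algebra_simps)
qed

lemma ex_critical:
  assumes "0 < \<mu>" "0 < s0" "B - R s0 = \<mu>"
  shows "\<exists>s>s0. P s * (s + \<mu>) = B - R s - \<mu>"
proof -
  let ?k = "\<lambda>s. P s * (s + \<mu>) + R s"
  \<comment> \<open>\<open>R s0\<close> alone already equals \<open>B - \<mu>\<close>, and the other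
    summand is positive.\<close>
  have start: "B - \<mu> < ?k s0" using assms mult_pos_pos[OF P_pos[of s0], of "s0 + \<mu>"] by linarith
  have B: "0 < B - \<mu>" using assms R_pos[of s0] by simp
  \<comment> \<open>For \<open>s > 1\<close> one has \<open>P s \<le> s * P s \<le> R s\<close>, so
    \<open>?k s\<close> is at most \<open>(2 + \<mu>) * R s\<close>. The bound chosen for
    \<open>R\<close> pushes this below \<open>B - \<mu>\<close>.\<close>
  have "\<forall>\<^sub>F s in at_top. R s < (B - \<mu>) / (3 + \<mu>)"
    using R_tendsto_0 assms B by (intro order_tendstoD) auto
  hence "\<forall>\<^sub>F s in at_top. max s0 1 < s \<and> R s < (B - \<mu>) / (3 + \<mu>)"
    using eventually_gt_at_top[of "max s0 1"] by eventually_elim simp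
  then obtain s1 where s1: "s0 < s1" "1 < s1" "R s1 < (B - \<mu>) / (3 + \<mu>)"
    using eventually_happens'[OF trivial_limit_at_top_linorder] by force
  have "s1 * P s1 \<le> R s1"
  proof -
    have "s1 * P s1 = (LINT t|\<rho>. s1 * (1 / (t + s1)\<^sup>2))"
      unfolding P_def by (rule integral_mult_right_zero[symmetric])
    also have "\<dots> \<le> R s1"
      unfolding R_def
    proof (intro integral_mono integrable_mult_right integrable_P integrable_R)
      fix t assume "t \<in> space \<rho>"
      hence "s1 / (t + s1) \<le> 1" using s1 by (simp add: space_rho)
      hence "s1 / (t + s1) / (t + s1) \<le> 1 / (t + s1)"
        using \<open>t \<in> space \<rho>\<close> s1 by (intro divide_right_mono) (auto simp: space_rho)
      thus "s1 * (1 / (t + s1)\<^sup>2) \<le> 1 / (t + s1)" by (simp add: power2_eq_square)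
    qed (use s1 in auto)
    finally show ?thesis .
  qed
  moreover have "P s1 \<le> s1 * P s1" using s1 P_pos[of s1] by simp
  ultimately have "s1 * P s1 + \<mu> * P s1 \<le> R s1 + \<mu> * R s1"
    using assms by (intro add_mono mult_left_mono) auto
  hence "P s1 * (s1 + \<mu>) \<le> R s1 + \<mu> * R s1" by (simp add: algebra_simps)
  moreover have "(3 + \<mu>) * R s1 < B - \<mu>" using s1 assms by (simp add: field_simps)
  ultimately have stop: "?k s1 < B - \<mu>" using R_pos[of s1] s1 by (simp add: algebra_simps)
  have "continuous_on {s0..s1} ?k"
    using assms
    by (intro continuous_intros continuous_on_subset[OF continuous_R]
         continuous_on_subset[OF continuous_P[of s0]]) auto
  hence "\<exists>s. s0 \<le> s \<and> s \<le> s1 \<and> ?k s = B - \<mu>"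
    using IVT2'[of ?k s1 "B - \<mu>" s0] start stop s1 by simp
  then obtain s where s: "s0 \<le> s" "?k s = B - \<mu>" by blast
  moreover have "s \<noteq> s0" using s start by auto
  ultimately show ?thesis by (intro exI[of _ s]) auto
qed

text \<open>At the parameter \<open>x\<close> the price is \<open>B - R x - \<mu>\<close>. The chord
  inequalities compare increments of the price with increments of the parameter, and
  \<open>criterion_antimono\<close> decides the outcome on either side of the critical
  \<open>s\<close>.\<close>

lemma u_max_eq:
  assumes "0 < \<mu>" "0 < s0" "B - R s0 = \<mu>" "s0 < s" and crit: "P s * (s + \<mu>) = B - R s - \<mu>"
  shows "u_max M a (\<xi> + \<mu>) = P s * (s + \<mu>)"
proof -
  let ?f = "opt_prop M a (\<xi> + \<mu>)"
  define v where "v = P s * (s + \<mu>)"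
  have v: "0 < v" "v < B - \<mu>" "B - R s = \<mu> + v"
    using assms P_pos[of s] R_pos[of s] R_strict_antimono[of s0 s] crit by (auto simp: v_def)
  have diff: "game_E M a - ereal (\<xi> + \<mu>) = ereal (B - \<mu>)" by (simp add: E)
  have pair: "\<exists>x y. s0 < x \<and> x < y \<and> B - R x = \<mu> + u \<and> B - R y = \<mu> + w \<and>
      ?f u = u / (u + (x + \<mu>)) \<and> ?f w = w / (w + (y + \<mu>))"
    if uw: "0 < u" "u < w" "w < B - \<mu>" for u w
  proof -
    obtain x where x: "s0 < x" "B - R x = \<mu> + u"
      using ex_transform_eq[of s0 \<mu> u] assms(2,3) uw by auto
    obtain y where y: "s0 < y" "B - R y = \<mu> + w"
      using ex_transform_eq[of s0 \<mu> w] assms(2,3) uw by auto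
    have "R y < R x" using x(2) y(2) uw by simp
    hence "x < y"
      using R_strict_antimono[of y x] y(1) assms(2) by (cases x y rule: linorder_cases) auto
    moreover have "?f u = u / (u + (x + \<mu>))" "?f w = w / (w + (y + \<mu>))"
      using opt_prop_eq[of u \<mu> x] opt_prop_eq[of w \<mu> y] x y uw assms(1,2) by (auto simp: add_ac)
    ultimately show ?thesis using x y by blast
  qed
  have frac: "u / (u + p) < w / (w + q) \<longleftrightarrow> u * q < w * p"
    if "0 < u" "0 < w" "0 < p" "0 < q" for u w p q :: real
    using that by (simp add: field_simps)
  \<comment> \<open>Cross-multiplied, the goal is
    \<open>(y - x) * w < (y + \<mu>) * (w - u)\<close>. The secant slope
    \<open>(w - u) / (y - x)\<close> exceeds \<open>P y\<close>, and
    \<open>w < P y * (y + \<mu>)\<close> because \<open>y < s\<close>.\<close>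
  have inc: "strict_mono_on {0<..<v} ?f"
  proof (rule strict_mono_onI)
    fix u w assume uw: "u \<in> {0<..<v}" "w \<in> {0<..<v}" "u < w"
    then obtain x y where xy: "s0 < x" "x < y" "B - R x = \<mu> + u" "B - R y = \<mu> + w"
      "?f u = u / (u + (x + \<mu>))" "?f w = w / (w + (y + \<mu>))"
      using pair[of u w] v(2) by (smt (verit) greaterThanLessThan_iff)
    have "R s < R y" using v(3) xy(4) uw by simp
    hence "y < s"
      using R_strict_antimono[of s y] assms(2,4) by (cases s y rule: linorder_cases) auto
    hence "w < P y * (y + \<mu>)"
      using criterion_antimono[of \<mu> y s] xy(1,2,4) assms(1,2) crit by linarith
    hence "(y - x) * w < (y - x) * (P y * (y + \<mu>))" using xy by simp
    also have "\<dots> = (y + \<mu>) * ((y - x) * P y)" by (simp only: mult_ac)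
    also have "\<dots> < (y + \<mu>) * (w - u)"
    proof (rule mult_strict_left_mono)
      show "(y - x) * P y < w - u" using chord_lower[of x y] xy(1-4) assms(2) by linarith
    qed (use xy(1,2) assms(1,2) in linarith)
    finally have "u * (y + \<mu>) < w * (x + \<mu>)" by (simp add: algebra_simps)
    thus "?f u < ?f w" using uw xy(1,2) assms(1,2) frac[of u w "x + \<mu>" "y + \<mu>"] by (simp add: xy(5,6))
  qed
  \<comment> \<open>Here the goal becomes \<open>(x + \<mu>) * (w - u) < (y - x) * u\<close>. The
    secant slope is now bounded above by \<open>P x\<close>, the slope at the left endpoint, and
    \<open>P x * (x + \<mu>) < u\<close> because \<open>s < x\<close>.\<close>
  have dec: "strict_antimono_on {u. v < u \<and> ereal u < game_E M a - ereal (\<xi> + \<mu>)} ?f"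
  proof (rule monotone_onI)
    fix u w
    assume "u \<in> {u. v < u \<and> ereal u < game_E M a - ereal (\<xi> + \<mu>)}"
      "w \<in> {u. v < u \<and> ereal u < game_E M a - ereal (\<xi> + \<mu>)}" "u < w"
    hence uw: "v < u" "u < w" "w < B - \<mu>" by (auto simp: diff)
    then obtain x y where xy: "s0 < x" "x < y" "B - R x = \<mu> + u" "B - R y = \<mu> + w"
      "?f u = u / (u + (x + \<mu>))" "?f w = w / (w + (y + \<mu>))"
      using pair[of u w] v(1) by (smt (verit))
    have "R x < R s" using v(3) xy(3) uw by simp
    hence "s < x"
      using R_strict_antimono[of x s] assms(2) xy(1) by (cases x s rule: linorder_cases) auto
    hence "P x * (x + \<mu>) < u"
      using criterion_antimono[of \<mu> s x] xy(1,3) assms(1,2,4) crit by linarith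
    hence "(y - x) * (P x * (x + \<mu>)) < (y - x) * u" using xy by simp
    moreover have "(x + \<mu>) * (w - u) < (x + \<mu>) * ((y - x) * P x)"
    proof (rule mult_strict_left_mono)
      show "w - u < (y - x) * P x" using chord_upper[of x y] xy(1-4) assms(2) by linarith
    qed (use xy(1) assms(1,2) in linarith)
    ultimately have "w * (x + \<mu>) < u * (y + \<mu>)" by (simp add: algebra_simps)
    thus "?f u > ?f w" using uw xy(1,2) assms(1,2) v(1) frac[of w u "y + \<mu>" "x + \<mu>"] by (simp add: xy(5,6))
  qed
  have "u_max M a (\<xi> + \<mu>) = v"
    unfolding u_max_def
  proof (rule the_equality)
    show "0 < v \<and> ereal v < game_E M a - ereal (\<xi> + \<mu>) \<and> strict_mono_on {0<..<v} ?f \<and>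
        strict_antimono_on {u. v < u \<and> ereal u < game_E M a - ereal (\<xi> + \<mu>)} ?f"
      using v(1,2) inc dec unfolding diff by simp
  next
    fix v' assume v': "0 < v' \<and> ereal v' < game_E M a - ereal (\<xi> + \<mu>) \<and> strict_mono_on {0<..<v'} ?f \<and>
        strict_antimono_on {u. v' < u \<and> ereal u < game_E M a - ereal (\<xi> + \<mu>)} ?f"
    \<comment> \<open>Two different candidates would make the proportion both strictly increasing
      and strictly decreasing between them. This is the uniqueness that \<open>THE\<close> asks
      for.\<close>
    have no_overlap: False
      if "0 < p" "p < q" "q < B - \<mu>" "strict_mono_on {0<..<q} ?f"
        "strict_antimono_on {u. p < u \<and> ereal u < game_E M a - ereal (\<xi> + \<mu>)} ?f" for p q
    proof -
      obtain x where x: "p < x" "x < q" using dense[OF \<open>p < q\<close>] by blast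
      obtain y where y: "x < y" "y < q" using dense[OF \<open>x < q\<close>] by blast
      have "?f x < ?f y" using x y that by (intro strict_mono_onD[OF that(4)]) auto
      moreover have "?f x > ?f y" using x y that by (intro monotone_onD[OF that(5)]) (auto simp: diff)
      ultimately show False by simp
    qed
    show "v' = v"
      using no_overlap[of v v'] no_overlap[of v' v] v(1,2) v' inc dec unfolding diff
      by (cases v v' rule: linorder_cases) auto
  qed
  thus ?thesis by (simp add: v_def)
qed

text \<open>With \<open>\<mu> = m - \<xi>\<close> and \<open>y = P s * (s + \<mu>) / R s\<close>,
  the critical equation gives \<open>\<xi> + B - m = R s * (1 + y)\<close>, so the ratio is
  \<open>y / (1 + y)\<close>. Since \<open>\<mu>\<close> stays bounded, \<open>\<mu> / s\<close>
  tends to 0 and \<open>y\<close> tends to \<open>1 - r\<close>.\<close>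

lemma u_max_ratio_tendsto:
  assumes rv: "regularly_varying r N"
  shows "((\<lambda>m. u_max M a m / (\<xi> + B - m)) \<longlongrightarrow> (1 - r) / (2 - r)) (at_left (\<xi> + B))"
proof -
  \<comment> \<open>Above \<open>m0\<close> both \<open>\<mu> > 0\<close> and
    \<open>\<mu> > B - R 1\<close> hold; the latter makes \<open>\<mu>\<close> a value of
    \<open>B - R\<close> at some \<open>s0 > 1\<close>.\<close>
  define m0 where "m0 = \<xi> + max 0 (B - R 1)"
  have m0: "m0 < \<xi> + B" using R_pos[of 1] B_pos by (auto simp: m0_def)
  have "\<exists>s>0. R s < \<xi> + B - m \<and> P s * (s + (m - \<xi>)) = \<xi> + B - m - R s \<and>
      u_max M a m = P s * (s + (m - \<xi>))" if m: "m \<in> {m0<..<\<xi> + B}" for m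
  proof -
    define \<mu> where "\<mu> = m - \<xi>"
    have \<mu>: "0 < \<mu>" "B - R 1 < \<mu>" "\<mu> < B" using m by (auto simp: \<mu>_def m0_def)
    obtain s0 where s0: "1 < s0" "B - R s0 = \<mu>"
      using ex_transform_eq[of 1 "B - R 1" "\<mu> - (B - R 1)"] \<mu> by auto
    obtain s where s: "s0 < s" "P s * (s + \<mu>) = B - R s - \<mu>"
      using ex_critical[of \<mu> s0] s0 \<mu> by auto
    have "u_max M a (\<xi> + \<mu>) = P s * (s + \<mu>)"
      using u_max_eq[of \<mu> s0 s] s0 s \<mu> by auto
    moreover have "R s < R s0" using s s0 by (intro R_strict_antimono) auto
    ultimately show ?thesis using s s0 by (intro exI[of _ s]) (auto simp: \<mu>_def)
  qed
  then obtain S where S: "\<And>m. m \<in> {m0<..<\<xi> + B} \<Longrightarrow> 0 < S m \<and> R (S m) < \<xi> + B - m \<and>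
      P (S m) * (S m + (m - \<xi>)) = \<xi> + B - m - R (S m) \<and>
      u_max M a m = P (S m) * (S m + (m - \<xi>))"
    by metis
  have near: "\<forall>\<^sub>F m in at_left (\<xi> + B). m \<in> {max m0 x<..<\<xi> + B}" if "x < \<xi> + B" for x
    using m0 that by (intro eventually_at_left_real) auto
  \<comment> \<open>\<open>R (S m)\<close> is squeezed below \<open>\<xi> + B - m\<close>, and the
    decreasing function \<open>R\<close> is small only at large arguments.\<close>
  have lim: "filterlim S at_top (at_left (\<xi> + B))"
    unfolding filterlim_at_top_gt[where c = 0]
  proof (intro allI impI)
    fix K :: real assume K: "0 < K"
    have "\<forall>\<^sub>F m in at_left (\<xi> + B). m \<in> {max m0 (\<xi> + B - R K)<..<\<xi> + B}"
      using R_pos[OF K] by (intro near) auto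
    thus "\<forall>\<^sub>F m in at_left (\<xi> + B). K \<le> S m"
    proof eventually_elim
      case (elim m)
      hence "R (S m) < R K" "0 < S m" using S[of m] by auto
      thus ?case using R_strict_antimono[of "S m" K] by (cases "S m" K rule: linorder_cases) auto
    qed
  qed
  let ?y = "\<lambda>m. (1 + (m - \<xi>) / S m) * (S m * P (S m) / R (S m))"
  have "((\<lambda>m. (m - \<xi>) / S m) \<longlongrightarrow> 0) (at_left (\<xi> + B))"
    by (rule real_tendsto_divide_at_top[OF _ lim]) (rule tendsto_diff[OF tendsto_ident_at tendsto_const])
  hence y: "(?y \<longlongrightarrow> (1 + 0) * (1 - r)) (at_left (\<xi> + B))"
    using filterlim_compose[OF tendsto_log_derivative[OF rv] lim] by (intro tendsto_intros)
  \<comment> \<open>The bound \<open>r \<le> 1\<close> keeps the limit \<open>2 - r\<close> of the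
    denominator away from 0.\<close>
  have "((\<lambda>m. ?y m / (1 + ?y m)) \<longlongrightarrow> ((1 + 0) * (1 - r)) / (1 + (1 + 0) * (1 - r))) (at_left (\<xi> + B))"
    using regularly_varying_index_le_1[OF rv]
    by (intro tendsto_divide tendsto_add tendsto_const y) auto
  moreover have "\<forall>\<^sub>F m in at_left (\<xi> + B). ?y m / (1 + ?y m) = u_max M a m / (\<xi> + B - m)"
    using near[OF m0]
  proof eventually_elim
    case (elim m)
    define x where "x = P (S m) * (S m + (m - \<xi>))"
    have m: "m \<in> {m0<..<\<xi> + B}" using elim by simp
    have pos: "0 < S m" "0 < R (S m)" using S[OF m] R_pos by auto
    have x: "0 < x" "\<xi> + B - m = R (S m) + x" "u_max M a m = x"
      using S[OF m] by (auto simp: x_def)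
    have y: "?y m = x / R (S m)" using pos by (simp add: x_def field_simps)
    show ?case unfolding y x(2,3) using pos x(1) by (simp add: field_simps)
  qed
  ultimately show ?thesis by (subst (asm) tendsto_cong) simp_all
qed

end

section \<open>From a game with finite expectation to its transform\<close>

lemma game_E_eq_integral:
  assumes "prob_space M" "a \<in> borel_measurable M" "AE x in M. \<xi> \<le> a x" "game_E M a < \<infinity>"
  shows "integrable M a" "game_E M a = ereal (integral\<^sup>L M a)"
proof -
  interpret prob_space M by fact
  note [measurable] = assms(2)
  have neg: "(\<integral>\<^sup>+x. ennreal (- a x) \<partial>M) < \<infinity>"
  proof -
    have "(\<integral>\<^sup>+x. ennreal (- a x) \<partial>M) \<le> (\<integral>\<^sup>+x. ennreal (- \<xi>) \<partial>M)"
      using assms(3) by (intro nn_integral_mono_AE) (auto elim!: eventually_mono intro!: ennreal_leI)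
    also have "\<dots> < \<infinity>" by (simp add: emeasure_space_1)
    finally show ?thesis .
  qed
  have pos: "(\<integral>\<^sup>+x. ennreal (a x) \<partial>M) < \<infinity>"
  proof (rule ccontr)
    assume "\<not> ?thesis"
    hence "(\<integral>\<^sup>+x. ennreal (a x) \<partial>M) = \<infinity>" using not_less_iff_gr_or_eq top.not_eq_extremum by auto
    moreover obtain q where "(\<integral>\<^sup>+x. ennreal (- a x) \<partial>M) = ennreal q" "0 \<le> q"
      using neg by (cases "\<integral>\<^sup>+x. ennreal (- a x) \<partial>M") auto
    ultimately show False using assms(4) by (simp add: game_E_def)
  qed
  show int: "integrable M a"
    using pos neg by (subst real_integrable_def) auto
  have "enn2ereal (\<integral>\<^sup>+x. ennreal (f x) \<partial>M) = ereal (enn2real (\<integral>\<^sup>+x. ennreal (f x) \<partial>M))"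
    if "(\<integral>\<^sup>+x. ennreal (f x) \<partial>M) < \<infinity>" for f
    using that by (cases "\<integral>\<^sup>+x. ennreal (f x) \<partial>M") auto
  from this[OF pos] this[OF neg] show "game_E M a = ereal (integral\<^sup>L M a)"
    by (simp add: game_E_def real_lebesgue_integral_def[OF int])
qed

lemma prob_space_dF_on:
  assumes "distribution_function_on I F" shows "prob_space (dF_on I F)"
proof
  have one: "emeasure (interval_measure F) I = 1"
    using assms by (simp add: distribution_function_on_def)
  \<comment> \<open>\<open>emeasure\<close> is 0 outside the \<sigma>-algebra, so mass 1 forces
    \<open>I\<close> to be measurable.\<close>
  hence I: "I \<in> sets (interval_measure F)" using emeasure_notin_sets by fastforce
  have "emeasure (completion (interval_measure F)) I = 1"
    using one I by (simp add: emeasure_completion)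
  moreover have "space (dF_on I F) = I"
    by (simp add: dF_on_def space_restrict_space)
  ultimately show "emeasure (dF_on I F) (space (dF_on I F)) = 1"
    using I by (simp add: dF_on_def emeasure_restrict_space sets_completionI_sets)
qed

lemma ess_inf_AE:
  assumes "prob_space M" "- \<infinity> < ess_inf M a"
  shows "AE x in M. game_xi M a \<le> a x"
proof -
  interpret prob_space M by fact
  have AE: "AE x in M. ess_inf M a \<le> ereal (a x)"
    using esssup_AE[of "\<lambda>x. - ereal (a x)" M]
    by eventually_elim (simp add: ess_inf_def ereal_uminus_le_reorder)
  \<comment> \<open>\<open>real_of_ereal\<close> would turn \<open>\<infinity>\<close> into 0. That
    value is impossible because \<open>a\<close> is real-valued on a space of mass 1.\<close>
  have "ess_inf M a \<noteq> \<infinity>"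
  proof
    assume "ess_inf M a = \<infinity>"
    with AE have "AE x in M. False" by simp
    thus False by simp
  qed
  then obtain z where "ess_inf M a = ereal z" using assms by (cases "ess_inf M a") auto
  with AE show ?thesis by (simp add: game_xi_def)
qed

text \<open>Both terms of the difference diverge. Rewriting it as the quotient of the integrals of
  \<open>b x * (s / (b x + s))\<close> and \<open>s / (b x + s)\<close> removes the cancellation;
  these converge with the dominating functions \<open>b\<close> and 1.\<close>

lemma harmonic_mean_tendsto:
  fixes b :: "'a \<Rightarrow> real"
  assumes "prob_space M" and b: "integrable M b" and nonneg: "AE x in M. 0 \<le> b x"
  shows "((\<lambda>s. 1 / (LINT x|M. 1 / (b x + s)) - s) \<longlongrightarrow> integral\<^sup>L M b) at_top"
proof -
  interpret prob_space M by fact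
  note [measurable] = borel_measurable_integrable[OF b]
  have 1: "((\<lambda>s. LINT x|M. s / (b x + s)) \<longlongrightarrow> (LINT x|M. 1)) at_top"
  proof (rule integral_dominated_convergence_at_top[where w = "\<lambda>_. 1"])
    show "AE x in M. ((\<lambda>s. s / (b x + s)) \<longlongrightarrow> 1) at_top"
      by (intro AE_I2) real_asymp
    show "\<forall>\<^sub>F s in at_top. AE x in M. norm (s / (b x + s)) \<le> 1"
      using eventually_gt_at_top[of 0]
      by eventually_elim (use nonneg in \<open>auto elim!: eventually_mono\<close>)
  qed auto
  have 2: "((\<lambda>s. LINT x|M. b x * (s / (b x + s))) \<longlongrightarrow> (LINT x|M. b x)) at_top"
  proof (rule integral_dominated_convergence_at_top[where w = b])
    show "AE x in M. ((\<lambda>s. b x * (s / (b x + s))) \<longlongrightarrow> b x) at_top"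
      by (intro AE_I2) real_asymp
    show "\<forall>\<^sub>F s in at_top. AE x in M. norm (b x * (s / (b x + s))) \<le> b x"
      using eventually_gt_at_top[of 0]
    proof eventually_elim
      case (elim s)
      from nonneg show ?case
      proof eventually_elim
        case (elim x)
        have "b x * (s / (b x + s)) \<le> b x * 1"
          using elim \<open>0 < s\<close> by (intro mult_left_mono) auto
        thus ?case using elim \<open>0 < s\<close> by simp
      qed
    qed
  qed (auto simp: b)
  have "((\<lambda>s. (LINT x|M. b x * (s / (b x + s))) / (LINT x|M. s / (b x + s)))
      \<longlongrightarrow> (LINT x|M. b x) / (LINT x|M. 1)) at_top"
    using 1 2 by (intro tendsto_intros) (auto simp: prob_space)
  moreover have "\<forall>\<^sub>F s in at_top. (LINT x|M. b x * (s / (b x + s))) / (LINT x|M. s / (b x + s)) =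
      1 / (LINT x|M. 1 / (b x + s)) - s"
    using eventually_gt_at_top[of 0]
  proof eventually_elim
    case (elim s)
    define g where "g = (LINT x|M. 1 / (b x + s))"
    have int: "integrable M (\<lambda>x. 1 / (b x + s))"
      using nonneg elim
      by (intro integrable_const_bound[where B = "1 / s"])
         (auto elim!: eventually_mono intro!: divide_left_mono)
    have "(LINT x|M. 0) < g"
      unfolding g_def
      by (intro integral_less_nonnull int)
         (use nonneg elim in \<open>auto simp: emeasure_space_1 elim!: eventually_mono\<close>)
    hence g: "0 < g" by simp
    have "(LINT x|M. s / (b x + s)) = (LINT x|M. s * (1 / (b x + s)))" by simp
    also have "\<dots> = s * g" unfolding g_def by (rule integral_mult_right_zero)
    finally have den: "(LINT x|M. s / (b x + s)) = s * g" .
    have "(LINT x|M. b x * (s / (b x + s))) = (LINT x|M. s - (s * s) * (1 / (b x + s)))"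
    proof (rule integral_cong_AE)
      show "AE x in M. b x * (s / (b x + s)) = s - (s * s) * (1 / (b x + s))"
        using nonneg
      proof eventually_elim
        case (elim x)
        hence "b x + s > 0" using \<open>0 < s\<close> by simp
        thus ?case by (simp add: field_simps)
      qed
    qed auto
    also have "\<dots> = s - s * s * g"
      unfolding g_def
      by (subst Bochner_Integration.integral_diff)
         (auto intro!: integrable_mult_right int simp: prob_space simp del: times_divide_eq_right)
    finally have num: "(LINT x|M. b x * (s / (b x + s))) = s - s * s * g" .
    show ?case unfolding num den g_def[symmetric] using g elim by (simp add: field_simps)
  qed
  ultimately show ?thesis by (subst (asm) tendsto_cong) (auto simp: prob_space)
qed

text \<open>The kernel \<open>s / (t * (t + s))\<close> increases to \<open>1 / t\<close>, while its
  integrals converge by \<open>harmonic_mean_tendsto\<close>. Monotone convergence then gives both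
  the integrability of \<open>1 / t\<close> and the value of its integral, and
  \<open>1 / t - s / (t * (t + s)) = 1 / (t + s)\<close>.\<close>

lemma associated_measure_representation:
  assumes M: "prob_space M" and int: "integrable M a" and ge: "AE x in M. game_xi M a \<le> a x"
    and assoc: "associated_measure M a \<rho>"
  shows "integrable \<rho> (\<lambda>t. 1 / t)"
    and "\<And>s. s > 0 \<Longrightarrow> 1 / (LINT x|M. 1 / (a x - game_xi M a + s)) - s =
      integral\<^sup>L M a - game_xi M a - (LINT t|\<rho>. 1 / (t + s))"
proof -
  interpret prob_space M by fact
  define \<xi> where "\<xi> = game_xi M a"
  define L where "L = game_lower M a - \<xi>"
  define \<phi> where "\<phi> s = 1 / (LINT x|M. 1 / (a x - \<xi> + s)) - s" for s
  have sets: "sets \<rho> = sets (restrict_space borel {0<..})"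
    and fin: "(\<integral>\<^sup>+t. ennreal (1 / (t * (t + 1))) \<partial>\<rho>) < \<infinity>"
    using assoc by (auto simp: associated_measure_def)
  have space: "space \<rho> = {0<..}"
    using sets_eq_imp_space_eq[OF sets] by (simp add: space_restrict_space)
  have meas [measurable (raw)]: "f \<in> borel_measurable \<rho>" if "f \<in> borel_measurable borel" for f :: "real \<Rightarrow> real"
    using measurable_restrict_space1[OF that, of "{0<..}"] measurable_cong_sets[OF sets refl] by blast
  have int1: "integrable \<rho> (\<lambda>t. 1 / (t * (t + 1)))"
    using fin by (intro integrableI_nonneg) (auto simp: space intro!: AE_I2)
  have ints: "integrable \<rho> (\<lambda>t. s / (t * (t + s)))" if s: "s > 0" for s
  proof (rule Bochner_Integration.integrable_bound)
    \<comment> \<open>The factor comes from \<open>s * (t + 1) \<le> max s 1 * (t + s)\<close>,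
      checked separately for \<open>s \<ge> 1\<close> and \<open>s < 1\<close>.\<close>
    show "integrable \<rho> (\<lambda>t. max s 1 * (1 / (t * (t + 1))))"
      using int1 by (rule integrable_mult_right)
    show "AE t in \<rho>. norm (s / (t * (t + s))) \<le> norm (max s 1 * (1 / (t * (t + 1))))"
    proof (rule AE_I2)
      fix t assume "t \<in> space \<rho>"
      hence t: "t > 0" by (simp add: space)
      have "s * (t + 1) \<le> max s 1 * (t + s)"
      proof (cases "s \<ge> 1")
        case True
        thus ?thesis using t by (simp add: max_def)
      next
        case False
        hence "t * s \<le> t" using t by simp
        thus ?thesis using False by (simp add: max_def algebra_simps)
      qed
      hence "s / (t + s) \<le> max s 1 / (t + 1)" using t s by (simp add: divide_simps)
      hence "s / (t + s) / t \<le> max s 1 / (t + 1) / t" using t by (intro divide_right_mono) auto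
      thus "norm (s / (t * (t + s))) \<le> norm (max s 1 * (1 / (t * (t + 1))))"
        using t s by (simp add: abs_mult mult.commute)
    qed
  qed auto
  have phi: "\<phi> s = L + (LINT t|\<rho>. s / (t * (t + s)))" if "s > 0" for s
  proof -
    have "game_Psi M a (s - \<xi>) = game_lower M a +
        (LINT t|\<rho>. (s - \<xi> + \<xi>) / (t * (t + (s - \<xi>) + \<xi>)))"
      using assoc that unfolding associated_measure_def \<xi>_def
      by (metis diff_gt_0_iff_gt diff_minus_eq_add less_add_same_cancel2 diff_add_cancel)
    moreover have "game_Psi M a (s - \<xi>) = \<phi> s + \<xi>"
      by (simp add: game_Psi_def \<phi>_def add_diff_eq diff_add_eq)
    ultimately show ?thesis by (simp add: L_def add.assoc)
  qed
  have lim: "(\<phi> \<longlongrightarrow> integral\<^sup>L M a - \<xi>) at_top"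
  proof -
    have "(\<phi> \<longlongrightarrow> (LINT x|M. a x - \<xi>)) at_top"
      unfolding \<phi>_def using ge int
      by (intro harmonic_mean_tendsto M) (auto simp: \<xi>_def)
    thus ?thesis using int by (simp add: prob_space)
  qed
  \<comment> \<open>Monotone convergence is applied along the integers, and \<open>Suc n\<close>
    keeps the parameter positive.\<close>
  have "(\<lambda>n. \<phi> (real (Suc n))) \<longlonglongrightarrow> integral\<^sup>L M a - \<xi>"
    by (rule filterlim_compose[OF lim]) (rule filterlim_compose[OF filterlim_real_sequentially filterlim_Suc])
  hence "(\<lambda>n. \<phi> (real (Suc n)) - L) \<longlonglongrightarrow> integral\<^sup>L M a - \<xi> - L"
    by (intro tendsto_intros)
  hence conv: "(\<lambda>n. LINT t|\<rho>. real (Suc n) / (t * (t + real (Suc n)))) \<longlonglongrightarrow> integral\<^sup>L M a - \<xi> - L"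
    using phi by simp
  have mono: "AE t in \<rho>. mono (\<lambda>n. real (Suc n) / (t * (t + real (Suc n))))"
  proof (intro AE_I2 monoI)
    fix t and x y :: nat assume "t \<in> space \<rho>" "x \<le> y"
    hence t: "0 < t" "t * real x \<le> t * real y" by (auto simp: space intro!: mult_left_mono)
    hence "real (Suc x) / (t + real (Suc x)) \<le> real (Suc y) / (t + real (Suc y))"
      using \<open>x \<le> y\<close> by (simp add: divide_simps) (simp add: algebra_simps)
    hence "real (Suc x) / (t + real (Suc x)) / t \<le> real (Suc y) / (t + real (Suc y)) / t"
      using t by (intro divide_right_mono) auto
    thus "real (Suc x) / (t * (t + real (Suc x))) \<le> real (Suc y) / (t * (t + real (Suc y)))"
      by (simp add: mult.commute)
  qed
  have ptw: "AE t in \<rho>. (\<lambda>n. real (Suc n) / (t * (t + real (Suc n)))) \<longlonglongrightarrow> 1 / t"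
  proof (rule AE_I2)
    fix t assume "t \<in> space \<rho>"
    hence "t > 0" by (simp add: space)
    thus "(\<lambda>n. real (Suc n) / (t * (t + real (Suc n)))) \<longlonglongrightarrow> 1 / t"
      by real_asymp (simp add: field_simps)
  qed
  show inv: "integrable \<rho> (\<lambda>t. 1 / t)"
    by (rule integrable_monotone_convergence[OF _ mono ptw conv]) (auto intro!: ints)
  have val: "(LINT t|\<rho>. 1 / t) = integral\<^sup>L M a - \<xi> - L"
    by (rule integral_monotone_convergence[OF _ mono ptw conv]) (auto intro!: ints)
  fix s :: real assume s: "s > 0"
  have "(LINT t|\<rho>. 1 / (t + s)) = (LINT t|\<rho>. 1 / t - s / (t * (t + s)))"
  proof (intro Bochner_Integration.integral_cong refl)
    fix t assume "t \<in> space \<rho>"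
    hence "0 < t" "t + s \<noteq> 0" using s by (auto simp: space)
    thus "1 / (t + s) = 1 / t - s / (t * (t + s))" by (simp add: divide_simps)
  qed
  also have "\<dots> = (LINT t|\<rho>. 1 / t) - (LINT t|\<rho>. s / (t * (t + s)))"
    using inv ints[OF s] by (rule Bochner_Integration.integral_diff)
  finally show "1 / (LINT x|M. 1 / (a x - game_xi M a + s)) - s =
      integral\<^sup>L M a - game_xi M a - (LINT t|\<rho>. 1 / (t + s))"
    using phi[OF s] val by (simp add: \<phi>_def \<xi>_def)
qed

section \<open>The limit theorem for games\<close>

theorem theorem4p4:
  fixes I :: "real set" and a F :: "real \<Rightarrow> real" and \<rho> :: "real measure" and r :: real
  assumes "game I a F"
    and "associated_measure (dF_on I F) a \<rho>"
    and "game_E (dF_on I F) a < \<infinity>"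
    and "regularly_varying r (\<lambda>x. measure \<rho> {0<..x})"
  shows "0 \<le> r \<and> r \<le> 1 \<and>
    ((\<lambda>m. u_max (dF_on I F) a m / (real_of_ereal (game_E (dF_on I F) a) - m))
       \<longlongrightarrow> (1 - r) / (2 - r)) (at_left (real_of_ereal (game_E (dF_on I F) a)))"
proof -
  define M where "M = dF_on I F"
  define \<xi> where "\<xi> = game_xi M a"
  define B where "B = integral\<^sup>L M a - \<xi>"
  have game: "distribution_function_on I F" "a \<in> borel_measurable M"
    "\<not> (\<exists>k. AE x in M. a x = k)" "- \<infinity> < ess_inf M a"
    using assms(1) unfolding game_def M_def by blast+
  have M: "prob_space M" unfolding M_def by (rule prob_space_dF_on) fact
  have ge: "AE x in M. \<xi> \<le> a x" unfolding \<xi>_def by (rule ess_inf_AE) fact+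
  have int: "integrable M a" and E: "game_E M a = ereal (integral\<^sup>L M a)"
    using game_E_eq_integral[OF M game(2) ge] assms(3) by (auto simp: M_def)
  interpret prob_space M by (rule M)
  \<comment> \<open>\<open>B = 0\<close> would force \<open>a = \<xi>\<close> almost everywhere,
    against non-constancy.\<close>
  have "B \<noteq> 0"
  proof
    assume "B = 0"
    hence "(LINT x|M. a x - \<xi>) = 0" using int by (simp add: B_def prob_space)
    hence "AE x in M. a x - \<xi> = 0"
      using ge int by (subst (asm) integral_nonneg_eq_0_iff_AE) auto
    thus False using game(3) by auto
  qed
  moreover have "0 \<le> (LINT x|M. a x - \<xi>)" using ge by (intro integral_nonneg_AE) auto
  ultimately have B: "0 < B" using int by (simp add: B_def prob_space)
  note rep = associated_measure_representation[OF M int ge[unfolded \<xi>_def] assms(2)[folded M_def]]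
  \<comment> \<open>The eventual positivity contained in regular variation excludes
    \<open>\<rho> = 0\<close>, as the strict inequalities for \<open>R\<close> and \<open>P\<close>
    require.\<close>
  have N: "\<forall>\<^sub>F x in at_top. 0 < measure \<rho> {0<..x}"
    using assms(4) by (simp add: regularly_varying_def)
  then obtain x where x: "0 < measure \<rho> {0<..x}"
    using eventually_happens'[OF trivial_limit_at_top_linorder] by blast
  have "emeasure \<rho> (space \<rho>) \<noteq> 0"
  proof
    assume "emeasure \<rho> (space \<rho>) = 0"
    hence "emeasure \<rho> {0<..x} = 0"
      by (metis emeasure_space le_zero_eq)
    thus False using x by (simp add: measure_def)
  qed
  then interpret stieltjes_measure \<rho>
    using assms(2) rep(1) by unfold_locales (auto simp: associated_measure_def)
  interpret game_transform \<rho> M a B \<xi>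
    using game(2) ge E B rep(2) by unfold_locales (auto simp: \<xi>_def B_def R_def)
  have rv: "regularly_varying r N" using assms(4) by (simp add: N_def[abs_def])
  have "real_of_ereal (game_E M a) = \<xi> + B" by (simp add: E B_def)
  thus ?thesis
    using regularly_varying_index_nonneg[OF rv] regularly_varying_index_le_1[OF rv]
      u_max_ratio_tendsto[OF rv]
    by (simp add: M_def)
qed

end
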